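(* Let $(g_1,g_2)$ and $(\hat g_1,\hat g_2)$ be two pairs of holomorphic functions defined in a connected domain $\mathcal D\subset\mathbb C$, satisfying $g_1'g_2'\neq0$, $(|g_1|^2-1)(|g_2|^2-1)>0$, $\hat g_1'\hat g_2'\neq0$ and $(|\hat g_1|^2-1)(|\hat g_2|^2-1)>0$. To a pair $(g_1,g_2)$ associate the functions $$K=\frac{8|g_1'g_2'|}{(|g_1|^2-1)(|g_2|^2-1)}\left(\frac{|g_1'|^2}{(|g_1|^2-1)^2}+\frac{|g_2'|^2}{(|g_2|^2-1)^2}\right),\quad \varkappa=\frac{-8|g_1'g_2'|}{(|g_1|^2-1)(|g_2|^2-1)}\left(\frac{|g_1'|^2}{(|g_1|^2-1)^2}-\frac{|g_2'|^2}{(|g_2|^2-1)^2}\right),$$ which form a solution of the system $$\sqrt[4]{K^2-\varkappa^2}\;\Delta\ln\sqrt[4]{K^2-\varkappa^2}=2K,\qquad \sqrt[4]{K^2-\varkappa^2}\;\Delta\ln\sqrt{\frac{K+\varkappa}{K-\varkappa}}=2\varkappa,\qquad K^2-\varkappa^2>0,\ K>0.$$ Then the two pairs $(g_1,g_2)$ and $(\hat g_1,\hat g_2)$ generate one and the same solution $(K,\varkappa)$ if and only if there exist $\varepsilon\in\{1,-1\}$ and constants $a_1,b_1,a_2,b_2\in\mathbb C$ with $|a_1|^2-|b_1|^2=|a_2|^2-|b_2|^2=\varepsilon$ such that $$\hat g_1=\frac{a_1g_1+\bar b_1}{b_1g_1+\bar a_1},\qquad \hat g_2=\frac{a_2g_2+\bar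 b_2}{b_2g_2+\bar a_2}.$$
   Context: $\Delta=\partial_u^2+\partial_v^2$ is the ordinary Laplace operator in $\mathbb R^2\equiv\mathbb C$, $t=u+\mathrm i v$; primes denote complex derivatives with respect to $t$. *)

theory Defs
  imports "HOL-Complex_Analysis.Complex_Analysis"
begin

text \<open>Partial derivatives with respect to the real coordinates \<open>u\<close>, \<open>v\<close>, where \<open>t = u + \<i> v\<close>.\<close>

definition partial_u :: "(complex \<Rightarrow> real) \<Rightarrow> complex \<Rightarrow> real" where
  "partial_u f t = deriv (\<lambda>u. f (Complex u (Im t))) (Re t)"

definition partial_v :: "(complex \<Rightarrow> real) \<Rightarrow> complex \<Rightarrow> real" where
  "partial_v f t = deriv (\<lambda>v. f (Complex (Re t) v)) (Im t)"

definition laplacian :: "(complex \<Rightarrow> real) \<Rightarrow> complex \<Rightarrow> real" where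
  "laplacian f t = partial_u (partial_u f) t + partial_v (partial_v f) t"

text \<open>
  Class \<open>C\<^sup>2\<close>, intended for open \<open>D\<close>. Differentiability is demanded explicitly because
  \<^const>\<open>deriv\<close> is total.
\<close>

definition C2_on :: "complex set \<Rightarrow> (complex \<Rightarrow> real) \<Rightarrow> bool" where
  "C2_on D f \<longleftrightarrow>
     f differentiable_on D \<and> partial_u f differentiable_on D \<and> partial_v f differentiable_on D \<and>
     continuous_on D (partial_u (partial_u f)) \<and> continuous_on D (partial_u (partial_v f)) \<and>
     continuous_on D (partial_v (partial_u f)) \<and> continuous_on D (partial_v (partial_v f))"

definition is_solution :: "complex set \<Rightarrow> (complex \<Rightarrow> real) \<Rightarrow> (complex \<Rightarrow> real) \<Rightarrow> bool" where
  "is_solution D K \<kappa> \<longleftrightarrow>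
     C2_on D K \<and> C2_on D \<kappa> \<and>
     (\<forall>t\<in>D.
        root 4 ((K t)\<^sup>2 - (\<kappa> t)\<^sup>2) * laplacian (\<lambda>z. ln (root 4 ((K z)\<^sup>2 - (\<kappa> z)\<^sup>2))) t = 2 * K t \<and>
        root 4 ((K t)\<^sup>2 - (\<kappa> t)\<^sup>2) * laplacian (\<lambda>z. ln (sqrt ((K z + \<kappa> z) / (K z - \<kappa> z)))) t = 2 * \<kappa> t \<and>
        (K t)\<^sup>2 - (\<kappa> t)\<^sup>2 > 0 \<and> K t > 0)"

definition K_of :: "(complex \<Rightarrow> complex) \<Rightarrow> (complex \<Rightarrow> complex) \<Rightarrow> complex \<Rightarrow> real" where
  "K_of g1 g2 t =
     8 * cmod (deriv g1 t * deriv g2 t) / (((cmod (g1 t))\<^sup>2 - 1) * ((cmod (g2 t))\<^sup>2 - 1)) *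
     ((cmod (deriv g1 t))\<^sup>2 / ((cmod (g1 t))\<^sup>2 - 1)\<^sup>2 + (cmod (deriv g2 t))\<^sup>2 / ((cmod (g2 t))\<^sup>2 - 1)\<^sup>2)"

definition kappa_of :: "(complex \<Rightarrow> complex) \<Rightarrow> (complex \<Rightarrow> complex) \<Rightarrow> complex \<Rightarrow> real" where
  "kappa_of g1 g2 t =
     - 8 * cmod (deriv g1 t * deriv g2 t) / (((cmod (g1 t))\<^sup>2 - 1) * ((cmod (g2 t))\<^sup>2 - 1)) *
     ((cmod (deriv g1 t))\<^sup>2 / ((cmod (g1 t))\<^sup>2 - 1)\<^sup>2 - (cmod (deriv g2 t))\<^sup>2 / ((cmod (g2 t))\<^sup>2 - 1)\<^sup>2)"

definition admissible_pair :: "complex set \<Rightarrow> (complex \<Rightarrow> complex) \<Rightarrow> (complex \<Rightarrow> complex) \<Rightarrow> bool" where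
  "admissible_pair D g1 g2 \<longleftrightarrow>
     g1 holomorphic_on D \<and> g2 holomorphic_on D \<and>
     (\<forall>t\<in>D. deriv g1 t * deriv g2 t \<noteq> 0 \<and>
            ((cmod (g1 t))\<^sup>2 - 1) * ((cmod (g2 t))\<^sup>2 - 1) > 0)"

end

theory Submission
  imports Defs
begin

text \<open>
  Put \<open>q = \<bar>g'\<bar>\<^sup>2 / (\<bar>g\<bar>\<^sup>2 - 1)\<^sup>2\<close>. With \<open>q\<^sub>1, q\<^sub>2\<close> belonging to \<open>g\<^sub>1, g\<^sub>2\<close> one has
  \<open>K = 8 \<surd>(q\<^sub>1 q\<^sub>2) (q\<^sub>1 + q\<^sub>2)\<close> and \<open>\<kappa> = 8 \<surd>(q\<^sub>1 q\<^sub>2) (q\<^sub>2 - q\<^sub>1)\<close>, so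
  \<open>K\<^sup>2 - \<kappa>\<^sup>2 = (4 \<surd>(q\<^sub>1 q\<^sub>2))\<^sup>4\<close> and \<open>(K + \<kappa>) / (K - \<kappa>) = q\<^sub>2 / q\<^sub>1\<close>. The system then is
  Liouville's equation \<open>\<Delta> ln q = 8 q\<close> for both densities, and \<open>(K, \<kappa>)\<close> determines
  \<open>(q\<^sub>1, q\<^sub>2)\<close>. Two holomorphic functions \<open>g, h\<close> with the same density satisfy
  \<open>g' cnj g' (1 - h cnj h)\<^sup>2 = h' cnj h' (1 - g cnj g)\<^sup>2\<close>; both sides being sesqui-holomorphic,
  the conjugated factors may be evaluated at a fixed point \<open>t\<^sub>0\<close>. The resulting equation integrates
  to a Moebius relation between \<open>g\<close> and \<open>h\<close>.
\<close>

section \<open>Polarization of sesqui-holomorphic identities\<close>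

text \<open>
  Wirtinger differentiation with respect to \<open>t\<close> of the vanishing sum differentiates only the
  factors \<open>f i\<close>, so all derivatives of \<open>\<lambda>w. \<Sum>i\<in>I. f i w * cnj (k i z)\<close> vanish at \<open>z\<close>.
\<close>

lemma polarization:
  fixes f k :: "'i \<Rightarrow> complex \<Rightarrow> complex"
  assumes "open S" "connected S"
    and f: "\<And>i. i \<in> I \<Longrightarrow> f i holomorphic_on S" and k: "\<And>i. i \<in> I \<Longrightarrow> k i holomorphic_on S"
    and diag: "\<And>t. t \<in> S \<Longrightarrow> (\<Sum>i\<in>I. f i t * cnj (k i t)) = 0"
    and "z \<in> S" "w \<in> S"
  shows "(\<Sum>i\<in>I. f i w * cnj (k i z)) = 0"
proof -
  define F where "F n i = (deriv ^^ n) (f i)" for n i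
  have F: "F n i holomorphic_on S" if "i \<in> I" for n i
    unfolding F_def using f[OF that] \<open>open S\<close> by (rule holomorphic_higher_deriv)
  have F_deriv: "(F n i has_field_derivative F (Suc n) i t) (at t)" if "i \<in> I" "t \<in> S" for n i t
    using holomorphic_derivI[OF F[OF that(1)] \<open>open S\<close> that(2)] by (simp add: F_def)
  have F_diag: "(\<Sum>i\<in>I. F n i t * cnj (k i t)) = 0" if "t \<in> S" for n t
    using that
  proof (induction n arbitrary: t)
    case 0
    then show ?case using diag by (simp add: F_def)
  next
    case (Suc n)
    let ?L = "\<lambda>e. \<Sum>i\<in>I. F n i t * cnj (deriv (k i) t * e) + F (Suc n) i t * e * cnj (k i t)"
    have "((\<lambda>t. F n i t * cnj (k i t)) has_derivative
        (\<lambda>e. F n i t * cnj (deriv (k i) t * e) + F (Suc n) i t * e * cnj (k i t))) (at t)"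
      if "i \<in> I" for i
      using F_deriv[OF that Suc.prems, of n] holomorphic_derivI[OF k[OF that] \<open>open S\<close> Suc.prems]
      unfolding has_field_derivative_def
      by (intro has_derivative_mult has_derivative_cnj) auto
    then have "((\<lambda>t. \<Sum>i\<in>I. F n i t * cnj (k i t)) has_derivative ?L) (at t)"
      by (rule has_derivative_sum)
    moreover have "((\<lambda>t. \<Sum>i\<in>I. F n i t * cnj (k i t)) has_derivative (\<lambda>e. 0)) (at t)"
      by (rule has_derivative_transform_within_open[OF has_derivative_const \<open>open S\<close> Suc.prems])
        (use Suc.IH in auto)
    ultimately have L: "?L = (\<lambda>e. 0)"
      by (rule has_derivative_unique)
    \<comment> \<open>The differential in direction \<open>e\<close> is
      \<open>b * e + a * cnj e\<close>. The directions \<open>1\<close> and \<open>\<i>\<close>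
      together separate the complex-linear part \<open>b\<close> from the antilinear part
      \<open>a\<close>, and \<open>b = 0\<close> is the identity for the next order.\<close>
    define a where "a = (\<Sum>i\<in>I. F n i t * cnj (deriv (k i) t))"
    define b where "b = (\<Sum>i\<in>I. F (Suc n) i t * cnj (k i t))"
    have "?L 1 = a + b" by (simp add: a_def b_def sum.distrib)
    moreover have "?L \<i> = \<i> * (b - a)"
      by (simp add: a_def b_def sum.distrib sum_subtractf sum_distrib_left sum_negf algebra_simps)
    ultimately have "a + b = 0" "b - a = 0" using fun_cong[OF L, of 1] fun_cong[OF L, of \<i>] by simp_all
    then have "b = 0" by (simp add: algebra_simps)
    then show ?case by (simp add: b_def)
  qed
  let ?G = "\<lambda>w. \<Sum>i\<in>I. f i w * cnj (k i z)"
  have deriv_G: "(deriv ^^ n) ?G w = (\<Sum>i\<in>I. F n i w * cnj (k i z))" if "w \<in> S" for n w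
    using that
  proof (induction n arbitrary: w)
    case 0
    then show ?case by (simp add: F_def)
  next
    case (Suc n)
    have "((\<lambda>w. \<Sum>i\<in>I. F n i w * cnj (k i z)) has_field_derivative
        (\<Sum>i\<in>I. F (Suc n) i w * cnj (k i z))) (at w)"
      using F_deriv Suc.prems by (intro DERIV_sum DERIV_cmult_right) auto
    then have "((deriv ^^ n) ?G has_field_derivative (\<Sum>i\<in>I. F (Suc n) i w * cnj (k i z))) (at w)"
      by (rule has_field_derivative_transform_within_open[OF _ \<open>open S\<close> Suc.prems])
        (use Suc.IH in auto)
    then show ?case by (simp add: DERIV_imp_deriv)
  qed
  show ?thesis
  proof (rule holomorphic_fun_eq_0_on_connected[of ?G S z w])
    show "?G holomorphic_on S" using f by (intro holomorphic_intros) auto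
    show "(deriv ^^ n) ?G z = 0" for n using deriv_G F_diag \<open>z \<in> S\<close> by simp
  qed (use assms in auto)
qed

section \<open>Liouville densities and the polarized form of their equality\<close>

lemma cmod_square_neq_1: "cmod z \<noteq> 1 \<Longrightarrow> (cmod z)\<^sup>2 \<noteq> 1"
  by (metis norm_ge_zero real_sqrt_abs2 real_sqrt_one abs_of_nonneg power2_eq_square)

text \<open>Up to the factor 4, the density of the hyperbolic metric pulled back by
  \<open>g\<close>, from the unit disc or from its exterior.\<close>

definition liouville_density :: "(complex \<Rightarrow> complex) \<Rightarrow> complex \<Rightarrow> real" where
  "liouville_density g t = (cmod (deriv g t))\<^sup>2 / ((cmod (g t))\<^sup>2 - 1)\<^sup>2"

text \<open>By connectedness \<open>cmod (g t)\<close> stays on one side of 1, so a product of two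
  of its values cannot equal 1. This keeps the Blaschke denominators away from zero.\<close>

lemma one_minus_mult_cnj_nonzero:
  fixes g :: "complex \<Rightarrow> complex"
  assumes "connected D" "continuous_on D g" and ne: "\<And>t. t \<in> D \<Longrightarrow> cmod (g t) \<noteq> 1"
    and "s \<in> D" "t \<in> D"
  shows "1 - g s * cnj (g t) \<noteq> 0"
proof
  assume "1 - g s * cnj (g t) = 0"
  then have prod: "cmod (g s) * cmod (g t) = 1"
    by (metis complex_mod_cnj eq_iff_diff_eq_0 norm_mult norm_one)
  have "connected ((\<lambda>t. cmod (g t)) ` D)"
    using assms by (intro connected_continuous_image continuous_intros)
  then have conv: "\<And>x. \<lbrakk>cmod (g u) \<le> x; x \<le> cmod (g v); u \<in> D; v \<in> D\<rbrakk> \<Longrightarrow> x \<in> (\<lambda>t. cmod (g t)) ` D" for u v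
    by (meson connected_contains_Icc atLeastAtMost_iff image_eqI subsetD)
  have "1 \<notin> (\<lambda>t. cmod (g t)) ` D" using ne by auto
  then have "(cmod (g s) < 1 \<and> cmod (g t) < 1) \<or> (cmod (g s) > 1 \<and> cmod (g t) > 1)"
    using conv[of s 1 t] conv[of t 1 s] ne[of s] ne[of t] assms(4,5) by force
  then show False
    using prod mult_strict_mono[of "cmod (g s)" 1 "cmod (g t)" 1]
      less_1_mult[of "cmod (g s)" "cmod (g t)"] by auto
qed

lemma liouville_polarized:
  assumes "open D" "connected D" and g: "g holomorphic_on D" and h: "h holomorphic_on D"
    and ne: "\<And>t. t \<in> D \<Longrightarrow> cmod (g t) \<noteq> 1" "\<And>t. t \<in> D \<Longrightarrow> cmod (h t) \<noteq> 1"
    and eq: "\<And>t. t \<in> D \<Longrightarrow> liouville_density g t = liouville_density h t"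
    and "w \<in> D" "z \<in> D"
  shows "deriv g w * cnj (deriv g z) * (1 - h w * cnj (h z))\<^sup>2 =
         deriv h w * cnj (deriv h z) * (1 - g w * cnj (g z))\<^sup>2"
proof -
  note dg = holomorphic_deriv[OF g \<open>open D\<close>] and dh = holomorphic_deriv[OF h \<open>open D\<close>]
  \<comment> \<open>Expanding both squares gives three products on each side. Signs and binomial
    coefficients go into \<open>f\<close>, and \<open>k\<close> holds the factors to be conjugated.
    On the diagonal the sum is the equality of densities with denominators cleared.\<close>
  define f where "f = (\<lambda>i t. [deriv g t, - 2 * deriv g t * h t, deriv g t * (h t)\<^sup>2,
     - deriv h t, 2 * deriv h t * g t, - deriv h t * (g t)\<^sup>2] ! i)"
  define k where "k = (\<lambda>i t. [deriv g t, deriv g t * h t, deriv g t * (h t)\<^sup>2,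
     deriv h t, deriv h t * g t, deriv h t * (g t)\<^sup>2] ! i)"
  have sum: "(\<Sum>i<6. f i w * cnj (k i z)) =
      deriv g w * cnj (deriv g z) * (1 - h w * cnj (h z))\<^sup>2 -
      deriv h w * cnj (deriv h z) * (1 - g w * cnj (g z))\<^sup>2" for w z
    by (simp add: f_def k_def eval_nat_numeral) (simp add: algebra_simps power2_eq_square)
  have "(\<Sum>i<6. f i w * cnj (k i z)) = 0"
  proof (rule polarization[OF \<open>open D\<close> \<open>connected D\<close> _ _ _ \<open>z \<in> D\<close> \<open>w \<in> D\<close>])
    show "f i holomorphic_on D" "k i holomorphic_on D" if "i \<in> {..<6}" for i
    proof -
      have "i \<in> {0,1,2,3,4,5}" using that by auto
      then show "f i holomorphic_on D" "k i holomorphic_on D"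
        unfolding f_def k_def using g h dg dh by (auto intro!: holomorphic_intros)
    qed
    show "(\<Sum>i<6. f i t * cnj (k i t)) = 0" if "t \<in> D" for t
    proof -
      have "(cmod (g t))\<^sup>2 - 1 \<noteq> 0" "(cmod (h t))\<^sup>2 - 1 \<noteq> 0"
        using ne[OF that] by (simp_all add: cmod_square_neq_1)
      then have "(cmod (deriv g t))\<^sup>2 * (1 - (cmod (h t))\<^sup>2)\<^sup>2 = (cmod (deriv h t))\<^sup>2 * (1 - (cmod (g t))\<^sup>2)\<^sup>2"
        using eq[OF that] by (simp add: liouville_density_def frac_eq_eq power2_commute)
      then have "complex_of_real ((cmod (deriv g t))\<^sup>2 * (1 - (cmod (h t))\<^sup>2)\<^sup>2) =
          complex_of_real ((cmod (deriv h t))\<^sup>2 * (1 - (cmod (g t))\<^sup>2)\<^sup>2)" by (rule arg_cong)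
      then show ?thesis
        unfolding sum by (simp add: complex_norm_square[symmetric])
    qed
  qed
  then show ?thesis unfolding sum by simp
qed

section \<open>Real functions of class \<open>C\<^sup>k\<close> and the Laplacian\<close>

lemma has_derivative_partials:
  assumes "(f has_derivative f') (at t)"
  shows "partial_u f t = f' 1" "partial_v f t = f' \<i>"
proof -
  \<comment> \<open>The parameter \<open>r\<close> is kept general so that the line can be based on
    a coordinate axis: \<open>e = 1\<close>, \<open>r = Re t\<close> and \<open>e = \<i>\<close>,
    \<open>r = Im t\<close> then match the definitions of the two partial derivatives.\<close>
  have line: "((\<lambda>s. f (z + of_real s * e)) has_real_derivative f' e) (at r)"
    if "z + of_real r * e = t" for z e and r :: real
  proof -
    have "((\<lambda>s::real. z + of_real s * e) has_derivative (\<lambda>s. of_real s * e)) (at r)"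
      by (auto intro!: derivative_eq_intros)
    then have "((\<lambda>s. f (z + of_real s * e)) has_derivative (\<lambda>s. f' (of_real s * e))) (at r)"
      by (rule has_derivative_compose) (use assms that in simp)
    moreover have "f' (of_real s * e) = f' e * s" for s :: real
      using linear_cmul[OF has_derivative_linear[OF assms], of s e] by (simp add: scaleR_conv_of_real)
    ultimately show ?thesis by (simp add: has_field_derivative_def)
  qed
  show "partial_u f t = f' 1"
    unfolding partial_u_def using line[of "\<i> * Im t" "Re t" 1] complex_eq[of t]
    by (intro DERIV_imp_deriv) (simp add: Complex_eq add.commute)
  show "partial_v f t = f' \<i>"
    unfolding partial_v_def using line[of "Re t" "Im t" \<i>] complex_eq[of t]
    by (intro DERIV_imp_deriv) (simp add: Complex_eq mult.commute)
qed

lemma differentiable_has_derivative_partials: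
  assumes "f differentiable (at t)"
  shows "(f has_derivative (\<lambda>e. partial_u f t * Re e + partial_v f t * Im e)) (at t)"
proof -
  obtain f' where f': "(f has_derivative f') (at t)" using assms by (auto simp: differentiable_def)
  interpret linear f' using f' by (rule has_derivative_linear)
  have "f' e = partial_u f t * Re e + partial_v f t * Im e" for e
  proof -
    have "e = Re e *\<^sub>R 1 + Im e *\<^sub>R \<i>" by (simp add: complex_eq_iff)
    then have "f' e = f' (Re e *\<^sub>R 1 + Im e *\<^sub>R \<i>)" by simp
    also have "\<dots> = Re e *\<^sub>R f' 1 + Im e *\<^sub>R f' \<i>" by (simp only: add scale)
    finally show ?thesis by (simp add: has_derivative_partials[OF f'] mult.commute)
  qed
  then show ?thesis using f' by (metis (no_types, lifting) ext)
qed

text \<open>At \<open>n = 2\<close> this unfolds to the clauses of \<open>C2_on\<close>. The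
  recursive form allows closure properties to be proved by induction on the order.\<close>

primrec Ck_on :: "nat \<Rightarrow> complex set \<Rightarrow> (complex \<Rightarrow> real) \<Rightarrow> bool" where
  "Ck_on 0 D f \<longleftrightarrow> continuous_on D f"
| "Ck_on (Suc n) D f \<longleftrightarrow> f differentiable_on D \<and> Ck_on n D (partial_u f) \<and> Ck_on n D (partial_v f)"

lemma Ck_on_2_imp_C2_on: "Ck_on 2 D f \<Longrightarrow> C2_on D f"
  by (simp add: eval_nat_numeral C2_on_def)

context
  fixes D :: "complex set"
  assumes D: "open D"
begin

lemma Ck_on_has_derivative:
  assumes "Ck_on (Suc n) D f" "t \<in> D"
  shows "(f has_derivative (\<lambda>e. partial_u f t * Re e + partial_v f t * Im e)) (at t)"
  using assms D by (intro differentiable_has_derivative_partials)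
    (simp add: differentiable_on_eq_differentiable_at)

lemma has_derivative_cong_open:
  assumes "\<And>t. t \<in> D \<Longrightarrow> f t = g t" "t \<in> D" "(g has_derivative f') (at t)"
  shows "(f has_derivative f') (at t)"
  using has_derivative_transform_within_open[OF assms(3) D assms(2)] assms(1) by simp

text \<open>Since \<open>D\<close> is open, agreement on \<open>D\<close> is local agreement at each
  of its points, so the partial derivatives agree on \<open>D\<close> as well and the induction
  proceeds.\<close>

lemma Ck_on_cong:
  assumes "\<And>t. t \<in> D \<Longrightarrow> f t = g t" and "Ck_on n D g"
  shows "Ck_on n D f"
  using assms
proof (induction n arbitrary: f g)
  case 0
  then show ?case using continuous_on_cong[OF refl, of D f g] by simp
next
  case (Suc n)
  have der: "(f has_derivative (\<lambda>e. partial_u g t * Re e + partial_v g t * Im e)) (at t)" if "t \<in> D" for t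
    using Suc.prems(1) that Ck_on_has_derivative[OF Suc.prems(2) that] by (rule has_derivative_cong_open)
  have "f differentiable_on D"
    using der by (meson differentiable_at_withinI differentiable_def differentiable_on_def)
  moreover have "Ck_on n D (partial_u f)" "Ck_on n D (partial_v f)"
    using Suc.IH[of "partial_u f" "partial_u g"] Suc.IH[of "partial_v f" "partial_v g"] Suc.prems(2)
      has_derivative_partials[OF der] by simp_all
  ultimately show ?case by simp
qed

lemma Ck_on_SucI:
  assumes der: "\<And>t. t \<in> D \<Longrightarrow> (f has_derivative (\<lambda>e. p t * Re e + q t * Im e)) (at t)"
    and "Ck_on n D p" "Ck_on n D q"
  shows "Ck_on (Suc n) D f"
proof -
  have "f differentiable_on D"
    using der by (meson differentiable_at_withinI differentiable_def differentiable_on_def)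
  moreover have "Ck_on n D (partial_u f)" "Ck_on n D (partial_v f)"
    using has_derivative_partials[OF der] assms(2,3) by (auto intro: Ck_on_cong)
  ultimately show ?thesis by simp
qed

lemma Ck_on_Suc_imp: "Ck_on (Suc n) D f \<Longrightarrow> Ck_on n D f"
proof (induction n arbitrary: f)
  case 0
  then show ?case by (auto intro: differentiable_imp_continuous_on)
next
  case (Suc n)
  then show ?case by (metis Ck_on.simps(2))
qed

lemma Ck_on_const: "Ck_on n D (\<lambda>t. c)"
proof (induction n arbitrary: c)
  case (Suc n)
  show ?case by (rule Ck_on_SucI[of _ "\<lambda>t. 0" "\<lambda>t. 0"]) (use Suc in simp_all)
qed simp

lemma Ck_on_add:
  assumes "Ck_on n D f" "Ck_on n D g"
  shows "Ck_on n D (\<lambda>t. f t + g t)"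
  using assms
proof (induction n arbitrary: f g)
  case 0
  then show ?case by (simp add: continuous_on_add)
next
  case (Suc n)
  show ?case
  proof (rule Ck_on_SucI)
    show "((\<lambda>t. f t + g t) has_derivative (\<lambda>e. (partial_u f t + partial_u g t) * Re e +
        (partial_v f t + partial_v g t) * Im e)) (at t)" if "t \<in> D" for t
      using has_derivative_add[OF Suc.prems[THEN Ck_on_has_derivative[OF _ that]]]
      by (simp add: algebra_simps)
  qed (use Suc in auto)
qed

lemma Ck_on_mult:
  assumes "Ck_on n D f" "Ck_on n D g"
  shows "Ck_on n D (\<lambda>t. f t * g t)"
  using assms
proof (induction n arbitrary: f g)
  case 0
  then show ?case by (simp add: continuous_on_mult)
next
  case (Suc n)
  show ?case
  proof (rule Ck_on_SucI)
    show "((\<lambda>t. f t * g t) has_derivative (\<lambda>e. (f t * partial_u g t + partial_u f t * g t) * Re e +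
        (f t * partial_v g t + partial_v f t * g t) * Im e)) (at t)" if "t \<in> D" for t
      using has_derivative_mult[OF Suc.prems[THEN Ck_on_has_derivative[OF _ that]]]
      by (simp add: algebra_simps)
  next
    have lower: "Ck_on n D f" "Ck_on n D g" using Suc.prems by (blast intro: Ck_on_Suc_imp)+
    show "Ck_on n D (\<lambda>t. f t * partial_u g t + partial_u f t * g t)"
      "Ck_on n D (\<lambda>t. f t * partial_v g t + partial_v f t * g t)"
      by (intro Ck_on_add Suc.IH lower; use Suc.prems in simp)+
  qed
qed

text \<open>The chain rule trades smoothness of the outer function for smoothness of
  \<open>\<psi> (f t)\<close> one order lower. For the inverse and the square root,
  \<open>\<psi>\<close> is built from the function itself, so induction on the order closes.\<close>

lemma Ck_on_compose:
  assumes f: "Ck_on (Suc n) D f" and \<psi>: "Ck_on n D (\<lambda>t. \<psi> (f t))"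
    and der: "\<And>t. t \<in> D \<Longrightarrow> (\<phi> has_real_derivative \<psi> (f t)) (at (f t))"
  shows "Ck_on (Suc n) D (\<lambda>t. \<phi> (f t))"
proof (rule Ck_on_SucI)
  show "((\<lambda>t. \<phi> (f t)) has_derivative (\<lambda>e. (\<psi> (f t) * partial_u f t) * Re e + (\<psi> (f t) * partial_v f t) * Im e)) (at t)"
    if "t \<in> D" for t
    using has_derivative_compose[OF Ck_on_has_derivative[OF f that]
        der[OF that, unfolded has_field_derivative_def]]
    by (simp add: algebra_simps)
qed (use f \<psi> in \<open>auto intro!: Ck_on_mult\<close>)

lemma Ck_on_inverse:
  assumes "Ck_on n D f" "\<And>t. t \<in> D \<Longrightarrow> f t \<noteq> 0"
  shows "Ck_on n D (\<lambda>t. inverse (f t))"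
  using assms
proof (induction n)
  case 0
  then show ?case by (simp add: continuous_on_inverse)
next
  case (Suc n)
  then have IH: "Ck_on n D (\<lambda>t. inverse (f t))" using Ck_on_Suc_imp by blast
  show ?case
  proof (rule Ck_on_compose[OF Suc.prems(1), where \<psi> = "\<lambda>x. (- 1) * (inverse x * inverse x)"])
    show "(inverse has_real_derivative (- 1) * (inverse (f t) * inverse (f t))) (at (f t))" if "t \<in> D" for t
      using DERIV_inverse[of "f t"] Suc.prems(2)[OF that] by (simp add: eval_nat_numeral)
  qed (intro Ck_on_mult Ck_on_const IH)
qed

lemma Ck_on_sqrt:
  assumes "Ck_on n D f" "\<And>t. t \<in> D \<Longrightarrow> f t > 0"
  shows "Ck_on n D (\<lambda>t. sqrt (f t))"
  using assms
proof (induction n)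
  case 0
  then show ?case by (simp add: continuous_on_real_sqrt)
next
  case (Suc n)
  then have IH: "Ck_on n D (\<lambda>t. sqrt (f t))" using Ck_on_Suc_imp by blast
  show ?case
  proof (rule Ck_on_compose[OF Suc.prems(1), where \<psi> = "\<lambda>x. inverse (sqrt x) * (1/2)"])
    show "(sqrt has_real_derivative inverse (sqrt (f t)) * (1/2)) (at (f t))" if "t \<in> D" for t
      using DERIV_real_sqrt[OF Suc.prems(2)[OF that]] by simp
  next
    have "sqrt (f t) \<noteq> 0" if "t \<in> D" for t using Suc.prems(2)[OF that] by simp
    then show "Ck_on n D (\<lambda>t. inverse (sqrt (f t)) * (1/2))"
      by (intro Ck_on_mult Ck_on_const Ck_on_inverse[OF IH])
  qed
qed

lemma Ck_on_ln:
  assumes "Ck_on (Suc n) D f" "\<And>t. t \<in> D \<Longrightarrow> f t > 0"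
  shows "Ck_on (Suc n) D (\<lambda>t. ln (f t))"
proof (rule Ck_on_compose[OF assms(1), where \<psi> = inverse])
  show "Ck_on n D (\<lambda>t. inverse (f t))"
    by (intro Ck_on_inverse Ck_on_Suc_imp[OF assms(1)]) (use assms(2) in force)
qed (use assms(2) in \<open>rule DERIV_ln\<close>)

lemma Ck_on_Re:
  assumes "F holomorphic_on D"
  shows "Ck_on n D (\<lambda>t. Re (F t))"
  using assms
proof (induction n arbitrary: F)
  case 0
  then show ?case by (simp add: continuous_on_Re holomorphic_on_imp_continuous_on)
next
  case (Suc n)
  \<comment> \<open>The partial derivatives of \<open>Re F\<close> are the real parts of
    \<open>F'\<close> and \<open>\<i> * F'\<close>, again real parts of holomorphic functions, so
    the induction hypothesis covers both.\<close>
  have hol: "deriv F holomorphic_on D" "(\<lambda>t. \<i> * deriv F t) holomorphic_on D"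
    using Suc.prems D by (auto intro!: holomorphic_intros)
  show ?case
  proof (rule Ck_on_SucI[OF _ hol[THEN Suc.IH]])
    show "((\<lambda>t. Re (F t)) has_derivative (\<lambda>e. Re (deriv F t) * Re e + Re (\<i> * deriv F t) * Im e)) (at t)"
      if "t \<in> D" for t
      using has_derivative_Re[OF holomorphic_derivI[OF Suc.prems D that, unfolded has_field_derivative_def]]
      by (simp add: algebra_simps)
  qed
qed

lemma Ck_on_norm_square:
  assumes "F holomorphic_on D"
  shows "Ck_on n D (\<lambda>t. (cmod (F t))\<^sup>2)"
proof -
  \<comment> \<open>\<open>Im F\<close> enters as \<open>Re (- \<i> * F)\<close>, so that the result
    on real parts suffices.\<close>
  have "Ck_on n D (\<lambda>t. Re (F t) * Re (F t) + Re (- \<i> * F t) * Re (- \<i> * F t))"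
    by (intro Ck_on_add Ck_on_mult Ck_on_Re holomorphic_intros assms)
  then show ?thesis
    by (simp add: cmod_power2) (simp add: power2_eq_square)
qed

text \<open>The decomposition of \<open>h\<close> is required only on \<open>D\<close>, so
  \<open>h\<close> may be the literal logarithm from the system, whose splitting into logarithms of
  densities is valid only there.\<close>

lemma laplacian_lincomb:
  assumes "Ck_on 2 D f" "Ck_on 2 D g" "t \<in> D" and eq: "\<And>z. z \<in> D \<Longrightarrow> h z = c + a * f z + b * g z"
  shows "laplacian h t = a * laplacian f t + b * laplacian g t"
proof -
  have Ck: "Ck_on (Suc (Suc 0)) D f" "Ck_on (Suc (Suc 0)) D g" using assms by (simp_all add: eval_nat_numeral)
  have der: "(h has_derivative (\<lambda>e. a * (partial_u f z * Re e + partial_v f z * Im e) +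
      b * (partial_u g z * Re e + partial_v g z * Im e))) (at z)" if "z \<in> D" for z
    by (rule has_derivative_cong_open[OF eq that])
      (use Ck[THEN Ck_on_has_derivative[OF _ that]] in \<open>auto intro!: derivative_eq_intros\<close>)
  have partials: "partial_u h z = a * partial_u f z + b * partial_u g z"
      "partial_v h z = a * partial_v f z + b * partial_v g z" if "z \<in> D" for z
    using has_derivative_partials[OF der[OF that]] by simp_all
  have Cku: "Ck_on (Suc 0) D (partial_u f)" "Ck_on (Suc 0) D (partial_u g)"
    and Ckv: "Ck_on (Suc 0) D (partial_v f)" "Ck_on (Suc 0) D (partial_v g)" using Ck by auto
  have "(partial_u h has_derivative (\<lambda>e. a * (partial_u (partial_u f) t * Re e + partial_v (partial_u f) t * Im e) +
      b * (partial_u (partial_u g) t * Re e + partial_v (partial_u g) t * Im e))) (at t)"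
    by (rule has_derivative_cong_open[OF partials(1) \<open>t \<in> D\<close>])
      (use Cku[THEN Ck_on_has_derivative[OF _ \<open>t \<in> D\<close>]] in \<open>auto intro!: derivative_eq_intros\<close>)
  moreover have "(partial_v h has_derivative (\<lambda>e. a * (partial_u (partial_v f) t * Re e + partial_v (partial_v f) t * Im e) +
      b * (partial_u (partial_v g) t * Re e + partial_v (partial_v g) t * Im e))) (at t)"
    by (rule has_derivative_cong_open[OF partials(2) \<open>t \<in> D\<close>])
      (use Ckv[THEN Ck_on_has_derivative[OF _ \<open>t \<in> D\<close>]] in \<open>auto intro!: derivative_eq_intros\<close>)
  ultimately show ?thesis
    unfolding laplacian_def by (simp add: has_derivative_partials algebra_simps)
qed

text \<open>For \<open>c = 0\<close> this is harmonicity of \<open>ln \<bar>F\<bar>\<close>; for \<open>c = 1\<close> it is Liouville's equation.\<close>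

lemma laplacian_ln_norm_square_minus:
  assumes F: "F holomorphic_on D" and ne: "\<And>t. t \<in> D \<Longrightarrow> (cmod (F t))\<^sup>2 \<noteq> c" and "t \<in> D"
  shows "laplacian (\<lambda>t. ln (((cmod (F t))\<^sup>2 - c)\<^sup>2)) t = - 8 * c * (cmod (deriv F t))\<^sup>2 / ((cmod (F t))\<^sup>2 - c)\<^sup>2"
proof -
  define N where "N = (\<lambda>t. (cmod (F t))\<^sup>2 - c)"
  have N_nz: "N t \<noteq> 0" if "t \<in> D" for t using ne[OF that] by (simp add: N_def)
  have dF: "(F has_derivative (\<lambda>e. deriv F z * e)) (at z)"
    "(deriv F has_derivative (\<lambda>e. deriv (deriv F) z * e)) (at z)" if "z \<in> D" for z
    using holomorphic_derivI[OF F D that] holomorphic_derivI[OF holomorphic_deriv[OF F D] D that]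
    by (simp_all add: has_field_derivative_def)
  have N_eq: "N = (\<lambda>t. Re (F t) * Re (F t) + Im (F t) * Im (F t) - c)"
    by (simp add: N_def cmod_power2) (simp add: power2_eq_square)
  have dN: "(N has_derivative (\<lambda>e. 2 * Re (cnj (F z) * (deriv F z * e)))) (at z)" if "z \<in> D" for z
    unfolding N_eq using dF(1)[OF that]
    by (auto intro!: derivative_eq_intros simp: algebra_simps)
  \<comment> \<open>The square keeps the argument of \<open>ln\<close> positive for either sign of
    \<open>N\<close>.\<close>
  have dL: "((\<lambda>t. ln ((N t)\<^sup>2)) has_derivative (\<lambda>e. 4 * Re (cnj (F z) * (deriv F z * e)) / N z)) (at z)"
    if "z \<in> D" for z
  proof -
    have "((\<lambda>x. ln (x\<^sup>2)) has_real_derivative 2 / N z) (at (N z))"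
      using N_nz[OF that] by (auto intro!: derivative_eq_intros simp: power2_eq_square zero_less_mult_iff)
    from has_derivative_compose[OF dN[OF that] this[unfolded has_field_derivative_def]]
    show ?thesis by (rule has_derivative_eq_rhs) (simp add: fun_eq_iff)
  qed
  \<comment> \<open>Here \<open>e\<close> is the direction of the first derivative and
    \<open>d\<close> that of the second; \<open>e = d = 1\<close> and \<open>e = d = \<i>\<close>
    yield the two pure second partial derivatives.\<close>
  have dq: "((\<lambda>z. 4 * Re (cnj (F z) * (deriv F z * e)) / N z) has_derivative
      (\<lambda>d. 4 * (Re (cnj (deriv F t * d) * (deriv F t * e) + cnj (F t) * (deriv (deriv F) t * d * e)) * N t -
        Re (cnj (F t) * (deriv F t * e)) * (2 * Re (cnj (F t) * (deriv F t * d)))) / (N t)\<^sup>2)) (at t)" for e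
  proof -
    have "((\<lambda>z. 4 * Re (cnj (F z) * (deriv F z * e))) has_derivative
        (\<lambda>d. 4 * Re (cnj (F t) * (deriv (deriv F) t * d * e) + cnj (deriv F t * d) * (deriv F t * e)))) (at t)"
      by (intro has_derivative_mult_right has_derivative_Re has_derivative_mult has_derivative_cnj
          has_derivative_mult_left dF \<open>t \<in> D\<close>)
    from has_derivative_divide'[OF this dN[OF \<open>t \<in> D\<close>] N_nz[OF \<open>t \<in> D\<close>]]
    show ?thesis by (rule has_derivative_eq_rhs) (simp add: fun_eq_iff power2_eq_square algebra_simps)
  qed
  have pu: "partial_u (partial_u (\<lambda>t. ln ((N t)\<^sup>2))) t =
    4 * (Re (cnj (deriv F t) * deriv F t + cnj (F t) * deriv (deriv F) t) * N t -
        2 * (Re (cnj (F t) * deriv F t))\<^sup>2) / (N t)\<^sup>2"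
    using has_derivative_partials(1)[OF has_derivative_cong_open[OF has_derivative_partials(1)[OF dL] \<open>t \<in> D\<close> dq]]
    by (simp add: power2_eq_square)
  have pv: "partial_v (partial_v (\<lambda>t. ln ((N t)\<^sup>2))) t =
    4 * (Re (cnj (deriv F t) * deriv F t - cnj (F t) * deriv (deriv F) t) * N t -
        2 * (Im (cnj (F t) * deriv F t))\<^sup>2) / (N t)\<^sup>2"
    using has_derivative_partials(2)[OF has_derivative_cong_open[OF has_derivative_partials(2)[OF dL] \<open>t \<in> D\<close> dq]]
    by (simp add: power2_eq_square algebra_simps)
  \<comment> \<open>In the sum the terms with the second derivative of \<open>F\<close> cancel, and
    the squared real and imaginary parts of \<open>cnj F * F'\<close> combine to its squared
    modulus. Substituting \<open>\<bar>F\<bar>\<^sup>2 = N + c\<close> then leaves only the term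
    with \<open>c\<close>.\<close>
  have "laplacian (\<lambda>t. ln ((N t)\<^sup>2)) t =
    8 * ((cmod (deriv F t))\<^sup>2 * N t - (cmod (cnj (F t) * deriv F t))\<^sup>2) / (N t)\<^sup>2"
    unfolding laplacian_def pu pv add_divide_distrib[symmetric]
    by (simp only: cmod_power2) (simp add: algebra_simps power2_eq_square)
  also have "\<dots> = - 8 * c * (cmod (deriv F t))\<^sup>2 / (N t)\<^sup>2"
    by (simp add: N_def norm_mult power_mult_distrib algebra_simps)
  finally show ?thesis by (simp add: N_def)
qed

end

section \<open>Uniqueness for Liouville's equation\<close>

text \<open>The coefficient matrix has determinant \<open>\<epsilon>\<close> and multiplies the
  Hermitian form \<open>\<bar>x\<bar>\<^sup>2 - \<bar>y\<bar>\<^sup>2\<close> by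
  \<open>\<epsilon>\<close>. Hence \<open>h' = \<epsilon> g' / d\<^sup>2\<close> and
  \<open>\<bar>h\<bar>\<^sup>2 - 1 = \<epsilon> (\<bar>g\<bar>\<^sup>2 - 1) /
  \<bar>d\<bar>\<^sup>2\<close>; in the density both \<open>d\<close> and the sign drop out.\<close>

lemma liouville_density_moebius:
  assumes "open D" and g: "g holomorphic_on D" and "t \<in> D"
    and ab: "(cmod a)\<^sup>2 - (cmod b)\<^sup>2 = \<epsilon>" and eps: "\<epsilon> \<in> {1, -1}"
    and h: "\<And>t. t \<in> D \<Longrightarrow> b * g t + cnj a \<noteq> 0 \<and> h t = (a * g t + cnj b) / (b * g t + cnj a)"
  shows "liouville_density h t = liouville_density g t"
proof -
  define d where "d = b * g t + cnj a"
  have "d \<noteq> 0" using h[OF \<open>t \<in> D\<close>] by (simp add: d_def)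
  have eps_complex: "a * cnj a - b * cnj b = complex_of_real \<epsilon>"
    unfolding ab[symmetric] of_real_diff complex_norm_square ..
  have "((\<lambda>t. (a * g t + cnj b) / (b * g t + cnj a)) has_field_derivative
      (a * deriv g t * d - (a * g t + cnj b) * (b * deriv g t)) / (d * d)) (at t)"
    unfolding d_def
    by (rule DERIV_divide)
      (use holomorphic_derivI[OF g \<open>open D\<close> \<open>t \<in> D\<close>] h[OF \<open>t \<in> D\<close>] in \<open>auto intro!: derivative_eq_intros\<close>)
  also have "a * deriv g t * d - (a * g t + cnj b) * (b * deriv g t) = (a * cnj a - b * cnj b) * deriv g t"
    by (simp add: d_def algebra_simps)
  finally have "(h has_field_derivative \<epsilon> * deriv g t / (d * d)) (at t)"
    unfolding eps_complex
    by (rule has_field_derivative_transform_within_open[OF _ \<open>open D\<close> \<open>t \<in> D\<close>]) (simp add: h)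
  then have "deriv h t = \<epsilon> * deriv g t / (d * d)" by (rule DERIV_imp_deriv)
  then have dh: "cmod (deriv h t) = cmod (deriv g t) / (cmod d)\<^sup>2"
    using eps by (auto simp: norm_mult norm_divide power2_eq_square)
  have "complex_of_real ((cmod (a * g t + cnj b))\<^sup>2 - (cmod d)\<^sup>2) =
      (a * cnj a - b * cnj b) * (g t * cnj (g t) - 1)"
    unfolding of_real_diff complex_norm_square d_def by (simp add: algebra_simps)
  also have "\<dots> = complex_of_real (\<epsilon> * ((cmod (g t))\<^sup>2 - 1))"
    unfolding eps_complex by (simp add: complex_norm_square[symmetric])
  finally have num: "(cmod (a * g t + cnj b))\<^sup>2 - (cmod d)\<^sup>2 = \<epsilon> * ((cmod (g t))\<^sup>2 - 1)"
    by (simp only: of_real_eq_iff)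
  have "(cmod (h t))\<^sup>2 - 1 = ((cmod (a * g t + cnj b))\<^sup>2 - (cmod d)\<^sup>2) / (cmod d)\<^sup>2"
    using h[OF \<open>t \<in> D\<close>] \<open>d \<noteq> 0\<close> by (simp add: d_def norm_divide power_divide diff_divide_distrib)
  then have "(cmod (h t))\<^sup>2 - 1 = \<epsilon> * ((cmod (g t))\<^sup>2 - 1) / (cmod d)\<^sup>2"
    by (simp add: num)
  then show ?thesis
    unfolding liouville_density_def dh using \<open>d \<noteq> 0\<close> eps
    by (auto simp: power_divide power2_commute)
qed

text \<open>
  Fixing the second variable of the polarized identity at \<open>t\<^sub>0\<close> leaves an equation between the
  derivatives of \<open>(g - g\<^sub>0) / (1 - g \<cdot> cnj g\<^sub>0)\<close> and \<open>(h - h\<^sub>0) / (1 - h \<cdot> cnj h\<^sub>0)\<close>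
  up to a unimodular factor.
\<close>

lemma blaschke_factors_proportional:
  assumes D: "open D" "connected D" and g: "g holomorphic_on D" and h: "h holomorphic_on D"
    and ne: "\<And>t. t \<in> D \<Longrightarrow> cmod (g t) \<noteq> 1" "\<And>t. t \<in> D \<Longrightarrow> cmod (h t) \<noteq> 1"
    and dg: "\<And>t. t \<in> D \<Longrightarrow> deriv g t \<noteq> 0"
    and eq: "\<And>t. t \<in> D \<Longrightarrow> liouville_density g t = liouville_density h t"
    and "t0 \<in> D"
  obtains c where "cmod c = 1"
    "\<And>t. t \<in> D \<Longrightarrow> (h t - h t0) / (1 - h t * cnj (h t0)) = c * ((g t - g t0) / (1 - g t * cnj (g t0)))"
proof -
  define X where "X = (\<lambda>t. 1 - g t * cnj (g t0))"
  define Y where "Y = (\<lambda>t. 1 - h t * cnj (h t0))"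
  have X: "X t \<noteq> 0" and Y: "Y t \<noteq> 0" if "t \<in> D" for t
    using one_minus_mult_cnj_nonzero[OF D(2) holomorphic_on_imp_continuous_on[OF g] ne(1) that \<open>t0 \<in> D\<close>]
      one_minus_mult_cnj_nonzero[OF D(2) holomorphic_on_imp_continuous_on[OF h] ne(2) that \<open>t0 \<in> D\<close>]
    by (auto simp: X_def Y_def)
  have blaschke: "((\<lambda>t. (f t - f t0) / (1 - f t * cnj (f t0))) has_field_derivative
      deriv f t * (1 - f t0 * cnj (f t0)) / (1 - f t * cnj (f t0))\<^sup>2) (at t)"
    if "f holomorphic_on D" "1 - f t * cnj (f t0) \<noteq> 0" "t \<in> D" for f t
    using holomorphic_derivI[OF that(1) D(1) that(3)] that(2)
    by (auto intro!: derivative_eq_intros simp: power2_eq_square) (simp add: algebra_simps)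
  have pol: "deriv g w * cnj (deriv g t0) * (Y w)\<^sup>2 = deriv h w * cnj (deriv h t0) * (X w)\<^sup>2"
    if "w \<in> D" for w
    unfolding X_def Y_def by (rule liouville_polarized[OF D g h ne eq that \<open>t0 \<in> D\<close>])
  have X0: "X t0 \<noteq> 0" and Y0: "Y t0 \<noteq> 0" using X Y \<open>t0 \<in> D\<close> by auto
  have dg0: "deriv g t0 \<noteq> 0" using dg \<open>t0 \<in> D\<close> .
  have dh0: "deriv h t0 \<noteq> 0" using pol[OF \<open>t0 \<in> D\<close>] dg0 Y0 by auto
  \<comment> \<open>The constant ratio of the derivatives of the two Blaschke quotients:
    \<open>pol\<close> gives the quotient of the conjugated derivatives, and the numerators of
    \<open>blaschke\<close> contribute \<open>Y t0\<close> and \<open>X t0\<close>. Taking moduli in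
    \<open>pol\<close> at \<open>t0\<close> shows that \<open>c\<close> is unimodular.\<close>
  define c where "c = cnj (deriv g t0) * Y t0 / (cnj (deriv h t0) * X t0)"
  have "(cmod (deriv g t0) * cmod (Y t0))\<^sup>2 = (cmod (deriv h t0) * cmod (X t0))\<^sup>2"
    using arg_cong[OF pol[OF \<open>t0 \<in> D\<close>], of cmod]
    by (simp add: norm_mult power2_eq_square mult_ac)
  then have "cmod (deriv g t0) * cmod (Y t0) = cmod (deriv h t0) * cmod (X t0)"
    by (simp add: power2_eq_iff_nonneg)
  then have "cmod c = 1" using dh0 X0 by (simp add: c_def norm_mult norm_divide)
  moreover
  let ?\<Phi> = "\<lambda>t. (h t - h t0) / Y t - c * ((g t - g t0) / X t)"
  have "(?\<Phi> has_field_derivative 0) (at t)" if "t \<in> D" for t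
  proof -
    have "deriv h t * Y t0 / (Y t)\<^sup>2 = c * (deriv g t * X t0 / (X t)\<^sup>2)"
    proof -
      have ratio: "deriv h t / (Y t)\<^sup>2 = cnj (deriv g t0) / cnj (deriv h t0) * (deriv g t / (X t)\<^sup>2)"
        using pol[OF that] X[OF that] Y[OF that] dh0 by (simp add: frac_eq_eq mult_ac)
      have "deriv h t * Y t0 / (Y t)\<^sup>2 = Y t0 * (deriv h t / (Y t)\<^sup>2)" by simp
      also have "\<dots> = c * (deriv g t * X t0 / (X t)\<^sup>2)" unfolding ratio c_def using X0 by simp
      finally show ?thesis .
    qed
    moreover note DERIV_diff[OF blaschke[OF h Y[OF that, unfolded Y_def] that]
        DERIV_cmult[OF blaschke[OF g X[OF that, unfolded X_def] that], of c], folded X_def Y_def]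
    ultimately show ?thesis by (simp add: X_def Y_def)
  qed
  then have "?\<Phi> constant_on D"
    by (rule has_field_derivative_0_imp_constant_on) (use D in auto)
  then obtain e where e: "\<And>t. t \<in> D \<Longrightarrow> ?\<Phi> t = e"
    unfolding constant_on_def by blast
  have "e = 0" using e[OF \<open>t0 \<in> D\<close>] by simp
  then have "(h t - h t0) / Y t = c * ((g t - g t0) / X t)" if "t \<in> D" for t
    using e[OF that] by simp
  ultimately show ?thesis using that by (simp add: X_def Y_def)
qed

text \<open>Solving the proportionality of the Blaschke quotients for \<open>h\<close> gives a
  Moebius map of \<open>g\<close>, which is then normalized. Recording the sign explicitly at
  \<open>t0\<close> later allows the signs of the two components to be compared.\<close>

lemma liouville_unique:
  assumes D: "open D" "connected D" and g: "g holomorphic_on D" and h: "h holomorphic_on D"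
    and ne: "\<And>t. t \<in> D \<Longrightarrow> cmod (g t) \<noteq> 1" "\<And>t. t \<in> D \<Longrightarrow> cmod (h t) \<noteq> 1"
    and dg: "\<And>t. t \<in> D \<Longrightarrow> deriv g t \<noteq> 0"
    and eq: "\<And>t. t \<in> D \<Longrightarrow> liouville_density g t = liouville_density h t"
    and "t0 \<in> D"
  obtains a b where "(cmod a)\<^sup>2 - (cmod b)\<^sup>2 = sgn (((cmod (g t0))\<^sup>2 - 1) * ((cmod (h t0))\<^sup>2 - 1))"
    "\<And>t. t \<in> D \<Longrightarrow> b * g t + cnj a \<noteq> 0 \<and> h t = (a * g t + cnj b) / (b * g t + cnj a)"
proof -
  obtain c where c: "cmod c = 1" and
    ratio: "\<And>t. t \<in> D \<Longrightarrow> (h t - h t0) / (1 - h t * cnj (h t0)) = c * ((g t - g t0) / (1 - g t * cnj (g t0)))"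
    using blaschke_factors_proportional[OF assms] by blast
  define G H where "G = g t0" and "H = h t0"
  define \<rho> where "\<rho> = ((cmod G)\<^sup>2 - 1) * ((cmod H)\<^sup>2 - 1)"
  have nz: "(cmod (f t0))\<^sup>2 - 1 \<noteq> 0" if "\<And>t. t \<in> D \<Longrightarrow> cmod (f t) \<noteq> 1" for f :: "complex \<Rightarrow> complex"
    using that[OF \<open>t0 \<in> D\<close>] by (simp add: cmod_square_neq_1)
  have "\<rho> \<noteq> 0" using nz[of g] nz[of h] ne by (simp add: \<rho>_def G_def H_def)
  txt \<open>The phase \<open>\<mu>\<close>, a square root of \<open>1 / c\<close>, gives the four coefficients
    the conjugation symmetry \<open>a, cnj b; b, cnj a\<close>.\<close>
  define \<mu> where "\<mu> = cnj (csqrt c)"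
  have csqrt: "cmod (csqrt c) = 1" using c by simp
  have "\<mu> * csqrt c = 1"
    using complex_norm_square[of "csqrt c"] csqrt by (simp add: \<mu>_def mult.commute)
  then have c_mu: "\<mu> * c = csqrt c"
    by (metis mult.assoc mult.left_neutral power2_csqrt power2_eq_square)
  \<comment> \<open>Without this scaling
    \<open>\<bar>a\<bar>\<^sup>2 - \<bar>b\<bar>\<^sup>2\<close> would be \<open>\<rho>\<close>;
    dividing the coefficients by \<open>s\<close> turns it into \<open>sgn \<rho>\<close>.\<close>
  define s where "s = sqrt \<bar>\<rho>\<bar>"
  have s: "s > 0" "s\<^sup>2 = \<bar>\<rho>\<bar>" using \<open>\<rho> \<noteq> 0\<close> by (auto simp: s_def)
  \<comment> \<open>Solving \<open>(y - H) * (1 - x * cnj G) = c * (x - G) * (1 - y * cnj H)\<close>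
    for \<open>y\<close> produces a quotient whose coefficients of \<open>x\<close> are
    \<open>c - H * cnj G\<close> above and \<open>c * cnj H - cnj G\<close> below.\<close>
  define a where "a = \<mu> * (c - H * cnj G) / s"
  define b where "b = \<mu> * (c * cnj H - cnj G) / s"
  have cnj_mu: "cnj \<mu> = \<mu> * c" using c_mu by (simp add: \<mu>_def)
  have cc: "c * cnj c = 1" using complex_norm_square[of c] c by simp
  have cnj_a: "cnj a = \<mu> * (1 - c * cnj H * G) / s"
    using cc by (simp add: a_def cnj_mu algebra_simps)
  have cnj_b: "cnj b = \<mu> * (H - c * G) / s"
    using cc by (simp add: b_def cnj_mu algebra_simps)
  have "\<mu> * cnj \<mu> = 1" using \<open>\<mu> * csqrt c = 1\<close> by (simp add: \<mu>_def)
  have "complex_of_real ((cmod a)\<^sup>2 - (cmod b)\<^sup>2) = a * cnj a - b * cnj b"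
    by (simp only: of_real_diff complex_norm_square)
  also have "\<dots> = (\<mu> * cnj \<mu>) * ((c - H * cnj G) * (cnj c - cnj H * G) -
      (c * cnj H - cnj G) * (cnj c * H - G)) / (complex_of_real (s\<^sup>2))"
    by (simp add: a_def b_def power2_eq_square diff_divide_distrib[symmetric]) (simp add: algebra_simps)
  also have "\<dots> = (G * cnj G - 1) * (H * cnj H - 1) / \<bar>\<rho>\<bar>"
    unfolding \<open>\<mu> * cnj \<mu> = 1\<close> s using cc by (simp add: algebra_simps)
  also have "\<dots> = complex_of_real (\<rho> / \<bar>\<rho>\<bar>)"
    unfolding \<rho>_def of_real_divide of_real_mult of_real_diff complex_norm_square by simp
  finally have ab: "(cmod a)\<^sup>2 - (cmod b)\<^sup>2 = sgn \<rho>"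
    by (simp only: of_real_eq_iff real_sgn_eq)
  have "b * g t + cnj a \<noteq> 0 \<and> h t = (a * g t + cnj b) / (b * g t + cnj a)" if "t \<in> D" for t
  proof -
    define x y where "x = g t" and "y = h t"
    have X: "1 - x * cnj G \<noteq> 0" and Y: "1 - y * cnj H \<noteq> 0"
      using one_minus_mult_cnj_nonzero[OF D(2) holomorphic_on_imp_continuous_on[OF g] ne(1) that \<open>t0 \<in> D\<close>]
        one_minus_mult_cnj_nonzero[OF D(2) holomorphic_on_imp_continuous_on[OF h] ne(2) that \<open>t0 \<in> D\<close>]
      by (auto simp: x_def y_def G_def H_def)
    have eq: "(y - H) * (1 - x * cnj G) = c * (x - G) * (1 - y * cnj H)"
      using ratio[OF that] X Y by (simp add: x_def y_def G_def H_def field_simps)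
    \<comment> \<open>The denominator of the solved equation before phase and scale are applied. The
      next identity exhibits it as a factor of a nonzero product, so it cannot vanish.\<close>
    define den where "den = 1 - x * cnj G + cnj H * c * (x - G)"
    have "den * (1 - y * cnj H) = (1 - x * cnj G) * (1 - H * cnj H)"
      unfolding den_def using eq by algebra
    moreover have "1 - H * cnj H \<noteq> 0"
      using one_minus_mult_cnj_nonzero[OF D(2) holomorphic_on_imp_continuous_on[OF h] ne(2) \<open>t0 \<in> D\<close> \<open>t0 \<in> D\<close>]
      by (simp add: H_def)
    ultimately have "den \<noteq> 0" using X by auto
    have den: "b * x + cnj a = \<mu> / s * den"
      using s unfolding cnj_a by (simp add: b_def den_def field_simps)
    have num: "a * x + cnj b = \<mu> / s * (H * (1 - x * cnj G) + c * (x - G))"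
      using s unfolding cnj_b by (simp add: a_def field_simps)
    have "H * (1 - x * cnj G) + c * (x - G) = y * den"
      unfolding den_def using eq by algebra
    then have "a * x + cnj b = y * (b * x + cnj a)" using den num by simp
    moreover have "b * x + cnj a \<noteq> 0"
      using den \<open>den \<noteq> 0\<close> s \<open>\<mu> * csqrt c = 1\<close> by auto
    ultimately show ?thesis by (simp add: x_def y_def)
  qed
  with ab show ?thesis using that by (simp add: \<rho>_def G_def H_def)
qed

section \<open>The functions \<open>K\<close> and \<open>\<kappa>\<close>\<close>

lemma Ck_on_liouville_density:
  assumes D: "open D" and g: "g holomorphic_on D" and ne: "\<And>t. t \<in> D \<Longrightarrow> cmod (g t) \<noteq> 1"
  shows "Ck_on n D (liouville_density g)"
proof -
  have nz: "((cmod (g t))\<^sup>2 + (- 1)) * ((cmod (g t))\<^sup>2 + (- 1)) \<noteq> 0" if "t \<in> D" for t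
    using cmod_square_neq_1[OF ne[OF that]] by simp
  have "Ck_on n D (\<lambda>t. (cmod (deriv g t))\<^sup>2 * inverse (((cmod (g t))\<^sup>2 + (- 1)) * ((cmod (g t))\<^sup>2 + (- 1))))"
    using nz by (intro Ck_on_mult[OF D] Ck_on_inverse[OF D] Ck_on_add[OF D] Ck_on_const[OF D]
        Ck_on_norm_square[OF D] holomorphic_deriv[OF g D] g)
  then show ?thesis
    by (rule Ck_on_cong[OF D, rotated]) (simp add: liouville_density_def divide_inverse power2_eq_square)
qed

lemma liouville_density_pos:
  assumes "deriv g t \<noteq> 0" "cmod (g t) \<noteq> 1"
  shows "liouville_density g t > 0"
proof -
  have "(cmod (g t))\<^sup>2 - 1 \<noteq> 0"
    using cmod_square_neq_1[OF assms(2)] by simp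
  then show ?thesis using assms(1) by (simp add: liouville_density_def)
qed

text \<open>The logarithm splits into that of \<open>\<bar>g'\<bar>\<^sup>2\<close>, harmonic
  because \<open>g'\<close> is holomorphic without zeros, and that of the denominator, whose
  Laplacian is \<open>- 8\<close> times the density and enters with a minus sign.\<close>

lemma laplacian_ln_liouville_density:
  assumes D: "open D" and g: "g holomorphic_on D" and ne: "\<And>t. t \<in> D \<Longrightarrow> cmod (g t) \<noteq> 1"
    and dg: "\<And>t. t \<in> D \<Longrightarrow> deriv g t \<noteq> 0" and "t \<in> D"
  shows "laplacian (\<lambda>t. ln (liouville_density g t)) t = 8 * liouville_density g t"
proof -
  have nz: "(cmod (g t))\<^sup>2 \<noteq> 1" if "t \<in> D" for t
    using cmod_square_neq_1[OF ne[OF that]] .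
  note dg_hol = holomorphic_deriv[OF g D]
  have Ck: "Ck_on 2 D (\<lambda>t. ln (((cmod (F t))\<^sup>2 - c)\<^sup>2))"
    if "F holomorphic_on D" "\<And>t. t \<in> D \<Longrightarrow> (cmod (F t))\<^sup>2 \<noteq> c" for F c
  proof -
    have "Ck_on 2 D (\<lambda>t. ((cmod (F t))\<^sup>2 + (- c)) * ((cmod (F t))\<^sup>2 + (- c)))"
      by (intro Ck_on_mult[OF D] Ck_on_add[OF D] Ck_on_const[OF D] Ck_on_norm_square[OF D] that)
    then have "Ck_on (Suc 1) D (\<lambda>t. ((cmod (F t))\<^sup>2 - c)\<^sup>2)"
      unfolding Suc_1 by (simp add: power2_eq_square)
    then have "Ck_on (Suc 1) D (\<lambda>t. ln (((cmod (F t))\<^sup>2 - c)\<^sup>2))"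
      by (rule Ck_on_ln[OF D]) (use that(2) in simp)
    then show ?thesis unfolding Suc_1 .
  qed
  \<comment> \<open>The factor \<open>1 / 2\<close> and the subtracted \<open>0\<close> bring the
    harmonic term into the squared form with \<open>c = 0\<close>.\<close>
  have "ln (liouville_density g z) =
      0 + 1 / 2 * ln (((cmod (deriv g z))\<^sup>2 - 0)\<^sup>2) + (- 1) * ln (((cmod (g z))\<^sup>2 - 1)\<^sup>2)" if "z \<in> D" for z
    using dg[OF that] nz[OF that] by (simp add: liouville_density_def ln_div ln_realpow)
  then have "laplacian (\<lambda>t. ln (liouville_density g t)) t =
      1 / 2 * laplacian (\<lambda>z. ln (((cmod (deriv g z))\<^sup>2 - 0)\<^sup>2)) t +
      (- 1) * laplacian (\<lambda>z. ln (((cmod (g z))\<^sup>2 - 1)\<^sup>2)) t"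
    using dg nz by (intro laplacian_lincomb[OF D] Ck g dg_hol \<open>t \<in> D\<close>) auto
  then show ?thesis
    using laplacian_ln_norm_square_minus[OF D g nz \<open>t \<in> D\<close>]
      laplacian_ln_norm_square_minus[OF D dg_hol _ \<open>t \<in> D\<close>, of 0] dg
    by (simp add: liouville_density_def)
qed

lemma admissible_pairD:
  assumes "admissible_pair D g1 g2"
  shows "g1 holomorphic_on D" "g2 holomorphic_on D"
    "\<And>t. t \<in> D \<Longrightarrow> deriv g1 t \<noteq> 0" "\<And>t. t \<in> D \<Longrightarrow> deriv g2 t \<noteq> 0"
    "\<And>t. t \<in> D \<Longrightarrow> cmod (g1 t) \<noteq> 1" "\<And>t. t \<in> D \<Longrightarrow> cmod (g2 t) \<noteq> 1"
    "\<And>t. t \<in> D \<Longrightarrow> ((cmod (g1 t))\<^sup>2 - 1) * ((cmod (g2 t))\<^sup>2 - 1) > 0"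
proof -
  show "g1 holomorphic_on D" "g2 holomorphic_on D"
    using assms unfolding admissible_pair_def by blast+
  fix t assume "t \<in> D"
  then have "deriv g1 t * deriv g2 t \<noteq> 0"
    and pos: "((cmod (g1 t))\<^sup>2 - 1) * ((cmod (g2 t))\<^sup>2 - 1) > 0"
    using assms unfolding admissible_pair_def by blast+
  then show "deriv g1 t \<noteq> 0" "deriv g2 t \<noteq> 0" by simp_all
  show "((cmod (g1 t))\<^sup>2 - 1) * ((cmod (g2 t))\<^sup>2 - 1) > 0" by (rule pos)
  show "cmod (g1 t) \<noteq> 1" using pos by force
  show "cmod (g2 t) \<noteq> 1" using pos by force
qed

text \<open>Positivity of the product of the two denominators is what identifies
  \<open>sqrt (A * B)\<close> with the prefactor itself, not merely with its absolute value.\<close>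

lemma K_kappa_liouville_density:
  assumes "((cmod (g1 t))\<^sup>2 - 1) * ((cmod (g2 t))\<^sup>2 - 1) > 0"
  defines "A \<equiv> liouville_density g1 t" and "B \<equiv> liouville_density g2 t"
  shows "K_of g1 g2 t = 8 * sqrt (A * B) * (A + B)" "kappa_of g1 g2 t = 8 * sqrt (A * B) * (B - A)"
proof -
  have "A * B = (cmod (deriv g1 t * deriv g2 t) / (((cmod (g1 t))\<^sup>2 - 1) * ((cmod (g2 t))\<^sup>2 - 1)))\<^sup>2"
    by (simp add: A_def B_def liouville_density_def norm_mult power_divide power_mult_distrib)
  then have sqrt: "sqrt (A * B) = cmod (deriv g1 t * deriv g2 t) / (((cmod (g1 t))\<^sup>2 - 1) * ((cmod (g2 t))\<^sup>2 - 1))"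
    using assms(1) by (simp add: real_sqrt_abs)
  show "K_of g1 g2 t = 8 * sqrt (A * B) * (A + B)"
    unfolding sqrt unfolding K_of_def A_def B_def liouville_density_def by simp
  have "- 8 * p / x * (a - b) = 8 * (p / x) * (b - a)" for p x a b :: real
    using minus_mult_minus[of "8 * p / x" "b - a"] by simp
  then show "kappa_of g1 g2 t = 8 * sqrt (A * B) * (B - A)"
    unfolding sqrt unfolding kappa_of_def A_def B_def liouville_density_def .
qed

lemma K_kappa_sq_diff:
  fixes A B :: real
  assumes "A > 0" "B > 0"
  shows "(8 * sqrt (A * B) * (A + B))\<^sup>2 - (8 * sqrt (A * B) * (B - A))\<^sup>2 = (4 * sqrt (A * B)) ^ 4"
proof -
  define s where "s = sqrt (A * B)"
  have "s\<^sup>2 = A * B" using assms by (simp add: s_def)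
  have "(8 * s * (A + B))\<^sup>2 - (8 * s * (B - A))\<^sup>2 = 256 * (s\<^sup>2 * (A * B))"
    by (simp add: power2_eq_square algebra_simps)
  also have "\<dots> = (4 * s) ^ 4"
    unfolding \<open>s\<^sup>2 = A * B\<close>[symmetric] by (simp add: eval_nat_numeral)
  finally show ?thesis by (simp add: s_def)
qed

text \<open>Half the sum and half the difference of the two Liouville equations have right-hand
  sides \<open>4 * (A + B)\<close> and \<open>4 * (B - A)\<close>; multiplication by the fourth root
  \<open>4 * sqrt (A * B)\<close> turns these into \<open>2 * K\<close> and
  \<open>2 * \<kappa>\<close>.\<close>

lemma is_solution_K_kappa:
  assumes D: "open D" and adm: "admissible_pair D g1 g2"
  shows "is_solution D (K_of g1 g2) (kappa_of g1 g2)"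
proof -
  note g = admissible_pairD[OF adm]
  define A where "A = liouville_density g1"
  define B where "B = liouville_density g2"
  have pos: "A t > 0" "B t > 0" if "t \<in> D" for t
    unfolding A_def B_def using that by (intro liouville_density_pos g; assumption)+
  have CkA: "Ck_on n D A" and CkB: "Ck_on n D B" for n
    unfolding A_def B_def by (intro Ck_on_liouville_density D g; assumption)+
  have K: "K_of g1 g2 t = 8 * sqrt (A t * B t) * (A t + B t)"
    and kappa: "kappa_of g1 g2 t = 8 * sqrt (A t * B t) * (B t - A t)" if "t \<in> D" for t
    using K_kappa_liouville_density[of g1 _ g2, OF g(7)[OF that]] by (simp_all add: A_def B_def)
  have sqrt: "Ck_on n D (\<lambda>t. sqrt (A t * B t))" for n
    using pos by (intro Ck_on_sqrt[OF D] Ck_on_mult[OF D] CkA CkB) simp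
  have "Ck_on 2 D (\<lambda>t. 8 * sqrt (A t * B t) * (A t + B t))"
    by (intro Ck_on_mult[OF D] Ck_on_add[OF D] Ck_on_const[OF D] sqrt CkA CkB)
  then have "Ck_on 2 D (K_of g1 g2)" by (rule Ck_on_cong[OF D, rotated]) (simp add: K)
  moreover have "Ck_on 2 D (\<lambda>t. 8 * sqrt (A t * B t) * (B t + (- 1) * A t))"
    by (intro Ck_on_mult[OF D] Ck_on_add[OF D] Ck_on_const[OF D] sqrt CkA CkB)
  then have "Ck_on 2 D (kappa_of g1 g2)" by (rule Ck_on_cong[OF D, rotated]) (simp add: kappa)
  moreover
  have root: "root 4 ((K_of g1 g2 t)\<^sup>2 - (kappa_of g1 g2 t)\<^sup>2) = 4 * sqrt (A t * B t)"
    and disc: "(K_of g1 g2 t)\<^sup>2 - (kappa_of g1 g2 t)\<^sup>2 > 0" and Kpos: "K_of g1 g2 t > 0"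
    and quot: "(K_of g1 g2 t + kappa_of g1 g2 t) / (K_of g1 g2 t - kappa_of g1 g2 t) = B t / A t"
    if "t \<in> D" for t
  proof -
    note p = pos[OF that]
    show "root 4 ((K_of g1 g2 t)\<^sup>2 - (kappa_of g1 g2 t)\<^sup>2) = 4 * sqrt (A t * B t)"
      unfolding K[OF that] kappa[OF that] K_kappa_sq_diff[OF p] using p by (intro real_root_power_cancel) auto
    show "(K_of g1 g2 t)\<^sup>2 - (kappa_of g1 g2 t)\<^sup>2 > 0"
      unfolding K[OF that] kappa[OF that] K_kappa_sq_diff[OF p] using p by simp
    show "K_of g1 g2 t > 0" unfolding K[OF that] using p by simp
    have "K_of g1 g2 t + kappa_of g1 g2 t = (16 * sqrt (A t * B t)) * B t"
      "K_of g1 g2 t - kappa_of g1 g2 t = (16 * sqrt (A t * B t)) * A t"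
      unfolding K[OF that] kappa[OF that] by (simp_all add: algebra_simps)
    then show "(K_of g1 g2 t + kappa_of g1 g2 t) / (K_of g1 g2 t - kappa_of g1 g2 t) = B t / A t"
      using p by simp
  qed
  have lnA: "Ck_on 2 D (\<lambda>t. ln (A t))" and lnB: "Ck_on 2 D (\<lambda>t. ln (B t))"
    using Ck_on_ln[OF D CkA[of "Suc 1"] pos(1)] Ck_on_ln[OF D CkB[of "Suc 1"] pos(2)] unfolding Suc_1 by blast+
  have lapA: "laplacian (\<lambda>t. ln (A t)) t = 8 * A t" and lapB: "laplacian (\<lambda>t. ln (B t)) t = 8 * B t"
    if "t \<in> D" for t
    using laplacian_ln_liouville_density[OF D g(1,5,3) that] laplacian_ln_liouville_density[OF D g(2,6,4) that]
    by (simp_all add: A_def B_def)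
  have lap: "laplacian (\<lambda>z. ln (root 4 ((K_of g1 g2 z)\<^sup>2 - (kappa_of g1 g2 z)\<^sup>2))) t = 4 * (A t + B t)"
    "laplacian (\<lambda>z. ln (sqrt ((K_of g1 g2 z + kappa_of g1 g2 z) / (K_of g1 g2 z - kappa_of g1 g2 z)))) t =
      4 * (B t - A t)" if "t \<in> D" for t
  proof -
    have "ln (root 4 ((K_of g1 g2 z)\<^sup>2 - (kappa_of g1 g2 z)\<^sup>2)) = ln 4 + 1 / 2 * ln (A z) + 1 / 2 * ln (B z)"
      if "z \<in> D" for z
      unfolding root[OF that] using pos[OF that] by (simp add: ln_mult ln_sqrt)
    from laplacian_lincomb[OF D lnA lnB that this]
    show "laplacian (\<lambda>z. ln (root 4 ((K_of g1 g2 z)\<^sup>2 - (kappa_of g1 g2 z)\<^sup>2))) t = 4 * (A t + B t)"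
      by (simp add: lapA lapB that)
    have "ln (sqrt ((K_of g1 g2 z + kappa_of g1 g2 z) / (K_of g1 g2 z - kappa_of g1 g2 z))) =
        0 + (- 1 / 2) * ln (A z) + 1 / 2 * ln (B z)"
      if "z \<in> D" for z
      unfolding quot[OF that] using pos[OF that] by (simp add: ln_div ln_sqrt)
    from laplacian_lincomb[OF D lnA lnB that this]
    show "laplacian (\<lambda>z. ln (sqrt ((K_of g1 g2 z + kappa_of g1 g2 z) / (K_of g1 g2 z - kappa_of g1 g2 z)))) t =
        4 * (B t - A t)"
      by (simp add: lapA lapB that)
  qed
  have "root 4 ((K_of g1 g2 t)\<^sup>2 - (kappa_of g1 g2 t)\<^sup>2) *
        laplacian (\<lambda>z. ln (root 4 ((K_of g1 g2 z)\<^sup>2 - (kappa_of g1 g2 z)\<^sup>2))) t = 2 * K_of g1 g2 t"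
    "root 4 ((K_of g1 g2 t)\<^sup>2 - (kappa_of g1 g2 t)\<^sup>2) *
        laplacian (\<lambda>z. ln (sqrt ((K_of g1 g2 z + kappa_of g1 g2 z) / (K_of g1 g2 z - kappa_of g1 g2 z)))) t =
        2 * kappa_of g1 g2 t" if "t \<in> D" for t
    unfolding root[OF that] lap[OF that] by (simp_all add: K[OF that] kappa[OF that])
  ultimately show ?thesis
    unfolding is_solution_def using disc Kpos Ck_on_2_imp_C2_on by blast
qed

lemma K_kappa_eq_iff:
  assumes "deriv g1 t \<noteq> 0" "deriv g2 t \<noteq> 0" "deriv h1 t \<noteq> 0" "deriv h2 t \<noteq> 0"
    and g: "((cmod (g1 t))\<^sup>2 - 1) * ((cmod (g2 t))\<^sup>2 - 1) > 0"
    and h: "((cmod (h1 t))\<^sup>2 - 1) * ((cmod (h2 t))\<^sup>2 - 1) > 0"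
  shows "K_of g1 g2 t = K_of h1 h2 t \<and> kappa_of g1 g2 t = kappa_of h1 h2 t \<longleftrightarrow>
    liouville_density g1 t = liouville_density h1 t \<and> liouville_density g2 t = liouville_density h2 t"
    (is "?L \<longleftrightarrow> ?R")
proof
  assume ?L
  define A B A' B' where "A = liouville_density g1 t" and "B = liouville_density g2 t"
    and "A' = liouville_density h1 t" and "B' = liouville_density h2 t"
  have ne: "cmod (g1 t) \<noteq> 1" "cmod (g2 t) \<noteq> 1" "cmod (h1 t) \<noteq> 1" "cmod (h2 t) \<noteq> 1"
    using g h by auto
  have pos: "A > 0" "B > 0" "A' > 0" "B' > 0"
    unfolding A_def B_def A'_def B'_def using ne assms(1-4) by (auto intro: liouville_density_pos)
  have eqs: "8 * sqrt (A * B) * (A + B) = 8 * sqrt (A' * B') * (A' + B')"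
    "8 * sqrt (A * B) * (B - A) = 8 * sqrt (A' * B') * (B' - A')"
    using \<open>?L\<close> K_kappa_liouville_density[of g1 t g2, OF g] K_kappa_liouville_density[of h1 t h2, OF h]
    by (simp_all add: A_def B_def A'_def B'_def)
  \<comment> \<open>The difference of squares recovers \<open>sqrt (A * B)\<close> from the two
    functions; cancelling it leaves \<open>A + B\<close> and \<open>B - A\<close>, which determine
    both densities.\<close>
  then have "(4 * sqrt (A * B)) ^ 4 = (4 * sqrt (A' * B')) ^ 4"
    unfolding K_kappa_sq_diff[OF pos(1,2), symmetric] K_kappa_sq_diff[OF pos(3,4), symmetric] by (simp only:)
  then have "4 * sqrt (A * B) = 4 * sqrt (A' * B')"
    by (rule power_eq_imp_eq_base) (use pos in auto)
  moreover have "sqrt (A' * B') \<noteq> 0" using pos by simp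
  ultimately have "A + B = A' + B'" "B - A = B' - A'" using eqs by simp_all
  then show ?R by (simp add: A_def B_def A'_def B'_def)
next
  assume ?R
  then show ?L
    using K_kappa_liouville_density[of g1 t g2, OF g] K_kappa_liouville_density[of h1 t h2, OF h] by simp
qed

section \<open>Classification of the pairs with a common solution\<close>

theorem theorem11p5:
  fixes D :: "complex set" and g1 g2 h1 h2 :: "complex \<Rightarrow> complex"
  assumes "open D" and "connected D" and "D \<noteq> {}"
    and "admissible_pair D g1 g2"
    and "admissible_pair D h1 h2"
  shows "is_solution D (K_of g1 g2) (kappa_of g1 g2) \<and>
    is_solution D (K_of h1 h2) (kappa_of h1 h2) \<and>
    ((\<forall>t\<in>D. K_of g1 g2 t = K_of h1 h2 t \<and> kappa_of g1 g2 t = kappa_of h1 h2 t) \<longleftrightarrow>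
     (\<exists>(\<epsilon>::real)\<in>{1, -1}. \<exists>a1 b1 a2 b2 :: complex.
        (cmod a1)\<^sup>2 - (cmod b1)\<^sup>2 = \<epsilon> \<and> (cmod a2)\<^sup>2 - (cmod b2)\<^sup>2 = \<epsilon> \<and>
        (\<forall>t\<in>D. b1 * g1 t + cnj a1 \<noteq> 0 \<and> h1 t = (a1 * g1 t + cnj b1) / (b1 * g1 t + cnj a1) \<and>
               b2 * g2 t + cnj a2 \<noteq> 0 \<and> h2 t = (a2 * g2 t + cnj b2) / (b2 * g2 t + cnj a2))))"
    (is "_ \<and> _ \<and> (?same \<longleftrightarrow> ?moebius)")
proof (intro conjI)
  note g = admissible_pairD[OF assms(4)] and h = admissible_pairD[OF assms(5)]
  have same_iff: "?same \<longleftrightarrow> (\<forall>t\<in>D. liouville_density g1 t = liouville_density h1 t \<and>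
      liouville_density g2 t = liouville_density h2 t)"
    by (intro ball_cong refl K_kappa_eq_iff g h; assumption)
  show "?same \<longleftrightarrow> ?moebius"
  proof
    assume ?same
    then have eq: "\<And>t. t \<in> D \<Longrightarrow> liouville_density g1 t = liouville_density h1 t"
      "\<And>t. t \<in> D \<Longrightarrow> liouville_density g2 t = liouville_density h2 t"
      using same_iff by auto
    obtain t0 where "t0 \<in> D" using \<open>D \<noteq> {}\<close> by blast
    define G1 G2 H1 H2 where "G1 = (cmod (g1 t0))\<^sup>2 - 1" and "G2 = (cmod (g2 t0))\<^sup>2 - 1"
      and "H1 = (cmod (h1 t0))\<^sup>2 - 1" and "H2 = (cmod (h2 t0))\<^sup>2 - 1"
    obtain a1 b1 where 1: "(cmod a1)\<^sup>2 - (cmod b1)\<^sup>2 = sgn (G1 * H1)"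
      "\<And>t. t \<in> D \<Longrightarrow> b1 * g1 t + cnj a1 \<noteq> 0 \<and> h1 t = (a1 * g1 t + cnj b1) / (b1 * g1 t + cnj a1)"
      unfolding G1_def H1_def
      by (rule liouville_unique[OF assms(1,2) g(1) h(1) g(5) h(5) g(3) eq(1) \<open>t0 \<in> D\<close>]) blast+
    obtain a2 b2 where 2: "(cmod a2)\<^sup>2 - (cmod b2)\<^sup>2 = sgn (G2 * H2)"
      "\<And>t. t \<in> D \<Longrightarrow> b2 * g2 t + cnj a2 \<noteq> 0 \<and> h2 t = (a2 * g2 t + cnj b2) / (b2 * g2 t + cnj a2)"
      unfolding G2_def H2_def
      by (rule liouville_unique[OF assms(1,2) g(2) h(2) g(6) h(6) g(4) eq(2) \<open>t0 \<in> D\<close>]) blast+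
    \<comment> \<open>\<open>G1\<close>, \<open>G2\<close> share a sign, and so do
      \<open>H1\<close>, \<open>H2\<close>; thus both components receive the same sign, which serves
      as the common \<open>\<epsilon>\<close>.\<close>
    have "G1 * G2 > 0" "H1 * H2 > 0"
      using g(7)[OF \<open>t0 \<in> D\<close>] h(7)[OF \<open>t0 \<in> D\<close>] by (simp_all add: G1_def G2_def H1_def H2_def)
    then have "sgn (G1 * H1) \<in> {1, -1}" "sgn (G2 * H2) = sgn (G1 * H1)"
      by (auto simp: sgn_mult zero_less_mult_iff)
    then show ?moebius
      using 1 2 by (intro bexI[of _ "sgn (G1 * H1)"] exI[of _ a1] exI[of _ b1] exI[of _ a2] exI[of _ b2]) simp_all
  next
    assume ?moebius
    then obtain \<epsilon> :: real and a1 b1 a2 b2 where eps: "\<epsilon> \<in> {1, -1}"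
      and ab: "(cmod a1)\<^sup>2 - (cmod b1)\<^sup>2 = \<epsilon>" "(cmod a2)\<^sup>2 - (cmod b2)\<^sup>2 = \<epsilon>"
      and 1: "\<And>t. t \<in> D \<Longrightarrow> b1 * g1 t + cnj a1 \<noteq> 0 \<and> h1 t = (a1 * g1 t + cnj b1) / (b1 * g1 t + cnj a1)"
      and 2: "\<And>t. t \<in> D \<Longrightarrow> b2 * g2 t + cnj a2 \<noteq> 0 \<and> h2 t = (a2 * g2 t + cnj b2) / (b2 * g2 t + cnj a2)"
      by blast
    show ?same
      unfolding same_iff
      using liouville_density_moebius[OF assms(1) g(1) _ ab(1) eps 1]
        liouville_density_moebius[OF assms(1) g(2) _ ab(2) eps 2] by simp
  qed
qed (use assms in \<open>auto intro: is_solution_K_kappa\<close>)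

end
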